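(* Let $k\ge 3$ and let $F$ be a $k$-graph that does not satisfy the following condition ($\spadesuit^*$): for each pair $i<j$ in $[k]$, the edge set of $F$ can be partitioned into two spanning subhypergraphs $F^1_{i,j}$ and $F^2_{i,j}$ such that there exists an ordering of $V(F)$ which is vanishing both for $F^1_{i,j}$ and $F^2_{i,j}$, and for every pair of edges $e_1\in E(F^1_{i,j})$, $e_2\in E(F^2_{i,j})$ with $|e_1\cap e_2|=k-1$, either $e_1\cap e_2$ is $\ell$-type with respect to both $F^1_{i,j}$ and $F^2_{i,j}$ for some $\ell\in[k]$, or $e_1\cap e_2$ is $i$-type with respect to $F^1_{i,j}$ and $j$-type with respect to $F^2_{i,j}$. Then $\pi_{k-2}(F)\ge 3(k+1)^{-k}>k^{-k}$.
   Context: A $k$-graph is a pair $H=(V,E)$ with $E$ a set of $k$-element subsets of $V$; $H$ is $F$-free if it has no subhypergraph isomorphic to $F$. For $0\le j<k$ and a $j$-graph $G$ on $V$, $\mathcal K_k(G)$ is the set of $k$-subsets of $V$ all of whose $j$-subsets are edges of $G$. A $k$-graph $H=(V,E)$ on $n$ vertices is $(d,\mu,j)$-dense if $|\mathcal K_k(G)\cap E|\ge d|\mathcal K_k(G)|-\mu n^k$ for every $j$-graph $G$ on $V$; $\pi_j(F)$ is the supremum of all $d\in[0,1]$ such that for every $\mu>0$ and $n_0$ there is an $F$-free $(d,\mu,j)$-dense $k$-graph with at least $n_0$ vertices. The shadow of $F$ is $\partial F=\{S:|S|=k-1,\ S\subset e\text{ for some }e\in E(F)\}$. An ordering $(v_1,\dots,v_f)$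 of $V(F)$ is vanishing for $F$ if $\partial F$ can be partitioned into $k$ disjoint sets $\mathcal C_1,\dots,\mathcal C_k$ such that for every edge $e=\{v_{i(1)},\dots,v_{i(k)}\}$ with $i(1)<\dots<i(k)$, $e\setminus\{v_{i(\ell)}\}\in\mathcal C_\ell$ for all $\ell\in[k]$. Given such an ordering, a $(k-1)$-set $S$ is $\ell$-type with respect to $F$ if there is a vertex $v$ with $S\cup\{v\}\in E(F)$ such that $v$ is in the $\ell$-th position of $S\cup\{v\}$ under the ordering. A spanning subhypergraph has vertex set $V(F)$. *)

theory Defs
  imports Complex_Main "HOL-Library.Ramsey" "HOL-Library.Disjoint_Sets"
begin

type_synonym 'a hypergraph = "'a set \<times> 'a set set"

abbreviation verts :: "'a hypergraph \<Rightarrow> 'a set" where "verts H \<equiv> fst H"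
abbreviation hedges :: "'a hypergraph \<Rightarrow> 'a set set" where "hedges H \<equiv> snd H"

definition kgraph :: "nat \<Rightarrow> 'a hypergraph \<Rightarrow> bool" where
  "kgraph k H \<longleftrightarrow> finite (verts H) \<and> hedges H \<subseteq> nsets (verts H) k"

definition subhypergraph :: "'a hypergraph \<Rightarrow> 'a hypergraph \<Rightarrow> bool" where
  "subhypergraph H' H \<longleftrightarrow>
     verts H' \<subseteq> verts H \<and> hedges H' \<subseteq> hedges H \<and> hedges H' \<subseteq> Pow (verts H')"

definition hisomorphic :: "'a hypergraph \<Rightarrow> 'b hypergraph \<Rightarrow> bool" where
  "hisomorphic F H \<longleftrightarrow>
     (\<exists>f. bij_betw f (verts F) (verts H) \<and> (\<lambda>e. f ` e) ` hedges F = hedges H)"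

definition hfree :: "'a hypergraph \<Rightarrow> 'b hypergraph \<Rightarrow> bool" where
  "hfree F H \<longleftrightarrow> \<not> (\<exists>H'. subhypergraph H' H \<and> hisomorphic F H')"

definition kcliques :: "nat \<Rightarrow> nat \<Rightarrow> 'a hypergraph \<Rightarrow> 'a set set" where
  "kcliques k j G = {K \<in> nsets (verts G) k. nsets K j \<subseteq> hedges G}"

definition dense_hypergraph ::
    "nat \<Rightarrow> real \<Rightarrow> real \<Rightarrow> nat \<Rightarrow> 'a hypergraph \<Rightarrow> bool" where
  "dense_hypergraph k d \<mu> j H \<longleftrightarrow>
     (\<forall>G. kgraph j G \<and> verts G = verts H \<longrightarrow>
        real (card (kcliques k j G \<inter> hedges H))
          \<ge> d * real (card (kcliques k j G)) - \<mu> * real (card (verts H)) ^ k)"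

text \<open>
  Host hypergraphs are finite, so up to isomorphism it suffices to take their vertices in
  \<^typ>\<open>nat\<close>. If \<open>F\<close> has an edge, the set below contains \<open>0\<close> and is bounded by \<open>1\<close>; if \<open>F\<close> has no
  edge, the set is empty and the supremum carries no information.
\<close>

definition turan_density :: "nat \<Rightarrow> nat \<Rightarrow> 'a hypergraph \<Rightarrow> real" where
  "turan_density k j F =
     Sup {d \<in> {0..1}. \<forall>\<mu>>0. \<forall>n\<^sub>0.
            \<exists>H :: nat hypergraph. kgraph k H \<and> card (verts H) \<ge> n\<^sub>0 \<and>
              hfree F H \<and> dense_hypergraph k d \<mu> j H}"

definition shadow :: "nat \<Rightarrow> 'a hypergraph \<Rightarrow> 'a set set" where
  "shadow k F = (\<Union>e\<in>hedges F. nsets e (k - 1))"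

definition vertex_ordering :: "'a list \<Rightarrow> 'a hypergraph \<Rightarrow> bool" where
  "vertex_ordering vs F \<longleftrightarrow> distinct vs \<and> set vs = verts F"

text \<open>Positions are counted from 1; meaningful for \<open>S \<subseteq> set vs\<close> and \<open>1 \<le> l \<le> card S\<close>.\<close>

definition vertex_at :: "'a list \<Rightarrow> 'a set \<Rightarrow> nat \<Rightarrow> 'a" where
  "vertex_at vs S l = filter (\<lambda>v. v \<in> S) vs ! (l - 1)"

text \<open>The classes \<open>C l\<close> may be empty.\<close>

definition vanishing :: "nat \<Rightarrow> 'a list \<Rightarrow> 'a hypergraph \<Rightarrow> bool" where
  "vanishing k vs F \<longleftrightarrow>
     vertex_ordering vs F \<and>
     (\<exists>C :: nat \<Rightarrow> 'a set set.
        (\<Union>l\<in>{1..k}. C l) = shadow k F \<and> disjoint_family_on C {1..k} \<and>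
        (\<forall>e\<in>hedges F. \<forall>l\<in>{1..k}. e - {vertex_at vs e l} \<in> C l))"

definition has_type :: "nat \<Rightarrow> 'a list \<Rightarrow> 'a hypergraph \<Rightarrow> nat \<Rightarrow> 'a set \<Rightarrow> bool" where
  "has_type k vs F l S \<longleftrightarrow>
     finite S \<and> card S = k - 1 \<and>
     (\<exists>v. insert v S \<in> hedges F \<and> vertex_at vs (insert v S) l = v)"

definition spade_star :: "nat \<Rightarrow> 'a hypergraph \<Rightarrow> bool" where
  "spade_star k F \<longleftrightarrow>
     (\<forall>i\<in>{1..k}. \<forall>j\<in>{1..k}. i < j \<longrightarrow>
        (\<exists>F1 F2 vs.
           verts F1 = verts F \<and> verts F2 = verts F \<and>
           hedges F1 \<union> hedges F2 = hedges F \<and> hedges F1 \<inter> hedges F2 = {} \<and>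
           vanishing k vs F1 \<and> vanishing k vs F2 \<and>
           (\<forall>e1\<in>hedges F1. \<forall>e2\<in>hedges F2. card (e1 \<inter> e2) = k - 1 \<longrightarrow>
              (\<exists>l\<in>{1..k}. has_type k vs F1 l (e1 \<inter> e2) \<and> has_type k vs F2 l (e1 \<inter> e2)) \<or>
              (has_type k vs F1 i (e1 \<inter> e2) \<and> has_type k vs F2 j (e1 \<inter> e2)))))"

end

theory Submission
  imports Defs "HOL-Library.FuncSet"
begin

text \<open>
  Let \<open>i < j\<close> be a pair violating the condition. Colour the \<open>(k - 1)\<close>-subsets of \<open>{0..<n}\<close> uniformly at
  random with \<open>k + 1\<close> colours, and let a \<open>k\<close>-set be an edge if the colours of its \<open>k\<close> facets, listed by
  the position of the omitted vertex, form one of three fixed patterns. An embedding of \<open>F\<close> would order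
  its vertices and, by the pattern of each edge, split \<open>F\<close> as the condition for \<open>i, j\<close> demands; hence
  the host is \<open>F\<close>-free. Each \<open>k\<close>-set is an edge with probability \<open>3 / (k + 1) ^ k\<close>. Recolouring one
  \<open>(k - 1)\<close>-set affects at most \<open>n\<close> edges, so by a bounded-differences inequality the density fails on
  a given \<open>(k - 2)\<close>-graph with probability \<open>exp (- c * n ^ (k - 1))\<close>, which beats the number
  \<open>2 ^ (n choose (k - 2))\<close> of such graphs.
\<close>

section \<open>A bounded-differences inequality for uniformly random functions\<close>

text \<open>For negative \<open>y\<close> put \<open>z = - y\<close>: in the product of
  \<open>1 - z + z\<^sup>2\<close> with the Taylor lower bound \<open>1 + z + z\<^sup>2 / 2\<close>
  of \<open>exp z\<close> the linear terms cancel and the rest is nonnegative, so the product is at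
  least 1.\<close>

lemma exp_le_quadratic:
  fixes y :: real
  assumes "\<bar>y\<bar> \<le> 1"
  shows "exp y \<le> 1 + y + y\<^sup>2"
proof (cases "y \<ge> 0")
  case True
  then show ?thesis using assms by (intro exp_bound) auto
next
  case False
  define z where "z = - y"
  have z: "0 \<le> z" using False by (simp add: z_def)
  have "1 \<le> 1 + z\<^sup>2 / 2 + z ^ 3 / 2 + z ^ 4 / 2"
    using z by simp
  also have "\<dots> = (1 - z + z\<^sup>2) * (1 + z + z\<^sup>2 / 2)"
    by (simp add: field_simps power2_eq_square power3_eq_cube power4_eq_xxxx)
  also have "\<dots> \<le> (1 - z + z\<^sup>2) * exp z"
  proof (rule mult_left_mono[OF exp_lower_Taylor_quadratic[OF z]])
    have "0 \<le> (1 - z)\<^sup>2 + z" using z by simp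
    then show "0 \<le> 1 - z + z\<^sup>2" using z by (simp add: power2_eq_square algebra_simps)
  qed
  finally have "exp (- z) \<le> 1 - z + z\<^sup>2"
    by (simp add: exp_minus field_simps)
  then show ?thesis by (simp add: z_def)
qed

lemma sum_PiE_insert:
  fixes h :: "('b \<Rightarrow> 'c) \<Rightarrow> 'd::comm_monoid_add"
  assumes "s \<notin> S"
  shows "(\<Sum>\<phi>\<in>Pi\<^sub>E (insert s S) T. h \<phi>) = (\<Sum>\<phi>\<in>Pi\<^sub>E S T. \<Sum>x\<in>T s. h (\<phi>(s := x)))"
proof -
  have "(\<Sum>\<phi>\<in>Pi\<^sub>E (insert s S) T. h \<phi>) = (\<Sum>(x, \<phi>)\<in>T s \<times> Pi\<^sub>E S T. h (\<phi>(s := x)))"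
    unfolding PiE_insert_eq by (subst sum.reindex[OF inj_combinator[OF assms]]) (simp add: case_prod_unfold)
  also have "\<dots> = (\<Sum>\<phi>\<in>Pi\<^sub>E S T. \<Sum>x\<in>T s. h (\<phi>(s := x)))"
    by (subst sum.cartesian_product[symmetric], rule sum.swap)
  finally show ?thesis .
qed

text \<open>An exponential moment of \<open>g\<close> around its mean, with expectations written as
  sums. The induction exposes one coordinate at a time: averaging over coordinate \<open>s\<close>
  gives \<open>g'\<close>, which still changes by at most \<open>c\<close> per coordinate, while
  \<open>g - g'\<close> has mean zero for fixed other coordinates and costs a factor
  \<open>exp (c\<^sup>2)\<close>.\<close>

lemma bounded_differences_exp_sum:
  fixes g :: "('b \<Rightarrow> 'c) \<Rightarrow> real"
  assumes "finite S" and "finite C" and "C \<noteq> {}" and "c \<le> 1"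
    and "\<And>\<phi> s x. \<phi> \<in> S \<rightarrow>\<^sub>E C \<Longrightarrow> s \<in> S \<Longrightarrow> x \<in> C \<Longrightarrow> \<bar>g (\<phi>(s := x)) - g \<phi>\<bar> \<le> c"
  shows "(\<Sum>\<phi>\<in>S \<rightarrow>\<^sub>E C. exp (g \<phi> - (\<Sum>\<psi>\<in>S \<rightarrow>\<^sub>E C. g \<psi>) / real (card (S \<rightarrow>\<^sub>E C))))
    \<le> real (card (S \<rightarrow>\<^sub>E C)) * exp (c\<^sup>2 * real (card S))"
  using assms(1,5)
proof (induction S arbitrary: g rule: finite_induct)
  case empty
  then show ?case by simp
next
  case (insert s S)
  let ?\<Phi> = "S \<rightarrow>\<^sub>E C" and ?q = "real (card C)"
  define g' where "g' \<phi> = (\<Sum>x\<in>C. g (\<phi>(s := x))) / ?q" for \<phi>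
  define m where "m = (\<Sum>\<psi>\<in>?\<Phi>. g' \<psi>) / real (card ?\<Phi>)"
  have q: "?q > 0" using assms by (simp add: card_gt_0_iff)
  have upd: "\<phi>(s := x) \<in> insert s S \<rightarrow>\<^sub>E C" if "\<phi> \<in> ?\<Phi>" "x \<in> C" for \<phi> x
    using that by (simp add: PiE_fun_upd)
  have card_ins: "card (insert s S \<rightarrow>\<^sub>E C) = card C * card ?\<Phi>"
    using insert.hyps by (simp add: card_funcsetE)
  have m: "(\<Sum>\<psi>\<in>insert s S \<rightarrow>\<^sub>E C. g \<psi>) / real (card (insert s S \<rightarrow>\<^sub>E C)) = m"
    unfolding m_def g'_def card_ins sum_PiE_insert[OF insert.hyps(2)]
    by (simp add: sum_divide_distrib[symmetric])
  have diff': "\<bar>g' (\<phi>(t := y)) - g' \<phi>\<bar> \<le> c" if "\<phi> \<in> ?\<Phi>" "t \<in> S" "y \<in> C" for \<phi> t y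
  proof -
    have "t \<noteq> s" using that insert.hyps by auto
    have "\<bar>g' (\<phi>(t := y)) - g' \<phi>\<bar> = \<bar>\<Sum>x\<in>C. g (\<phi>(s := x, t := y)) - g (\<phi>(s := x))\<bar> / ?q"
      using \<open>t \<noteq> s\<close> q by (simp add: g'_def sum_subtractf diff_divide_distrib[symmetric] fun_upd_twist)
    also have "\<dots> \<le> (\<Sum>x\<in>C. c) / ?q"
      using that q
      by (intro divide_right_mono order_trans[OF sum_abs] sum_mono insert.prems upd) auto
    finally show ?thesis using q by simp
  qed
  have one: "(\<Sum>x\<in>C. exp (g (\<phi>(s := x)) - g' \<phi>)) \<le> ?q * exp (c\<^sup>2)" if \<phi>: "\<phi> \<in> ?\<Phi>" for \<phi>
  proof -
    have bd: "\<bar>g (\<phi>(s := x)) - g' \<phi>\<bar> \<le> c" if x: "x \<in> C" for x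
    proof -
      \<comment> \<open>The deviation from the average is the mean, over \<open>y\<close>, of the
        changes caused by resetting \<open>s\<close> from \<open>y\<close> to
        \<open>x\<close>.\<close>
      have "\<bar>g (\<phi>(s := x)) - g' \<phi>\<bar> = \<bar>\<Sum>y\<in>C. g (\<phi>(s := y, s := x)) - g (\<phi>(s := y))\<bar> / ?q"
        using q by (simp add: g'_def sum_subtractf diff_divide_distrib[symmetric] field_simps)
      also have "\<dots> \<le> (\<Sum>y\<in>C. c) / ?q"
        using x q \<phi> by (intro divide_right_mono order_trans[OF sum_abs] sum_mono insert.prems upd) auto
      finally show ?thesis using q by simp
    qed
    have "(\<Sum>x\<in>C. exp (g (\<phi>(s := x)) - g' \<phi>))
        \<le> (\<Sum>x\<in>C. (1 + c\<^sup>2) + (g (\<phi>(s := x)) - g' \<phi>))"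
    proof (rule sum_mono)
      fix x assume x: "x \<in> C"
      have "exp (g (\<phi>(s := x)) - g' \<phi>)
          \<le> 1 + (g (\<phi>(s := x)) - g' \<phi>) + (g (\<phi>(s := x)) - g' \<phi>)\<^sup>2"
        using bd[OF x] assms(4) by (intro exp_le_quadratic) linarith
      moreover have "(g (\<phi>(s := x)) - g' \<phi>)\<^sup>2 \<le> c\<^sup>2"
        using bd[OF x] abs_le_square_iff[of "g (\<phi>(s := x)) - g' \<phi>" c] by linarith
      ultimately show "exp (g (\<phi>(s := x)) - g' \<phi>) \<le> (1 + c\<^sup>2) + (g (\<phi>(s := x)) - g' \<phi>)"
        by linarith
    qed
    \<comment> \<open>The linear terms sum to zero because \<open>g' \<phi>\<close> is the average
      of \<open>g (\<phi>(s := x))\<close> over \<open>x\<close>.\<close>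
    also have "\<dots> = ?q * (1 + c\<^sup>2)"
      using q by (simp add: sum.distrib sum_subtractf g'_def)
    also have "\<dots> \<le> ?q * exp (c\<^sup>2)"
      using q by (intro mult_left_mono) auto
    finally show ?thesis .
  qed
  have "(\<Sum>\<phi>\<in>insert s S \<rightarrow>\<^sub>E C. exp (g \<phi> - m))
      = (\<Sum>\<phi>\<in>?\<Phi>. exp (g' \<phi> - m) * (\<Sum>x\<in>C. exp (g (\<phi>(s := x)) - g' \<phi>)))"
    by (simp add: sum_PiE_insert[OF insert.hyps(2)] sum_distrib_left exp_add[symmetric])
  also have "\<dots> \<le> (\<Sum>\<phi>\<in>?\<Phi>. exp (g' \<phi> - m) * (?q * exp (c\<^sup>2)))"
    by (intro sum_mono mult_left_mono one) auto
  also have "\<dots> = ?q * exp (c\<^sup>2) * (\<Sum>\<phi>\<in>?\<Phi>. exp (g' \<phi> - m))"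
    by (simp add: sum_distrib_left mult_ac)
  also have "\<dots> \<le> ?q * exp (c\<^sup>2) * (real (card ?\<Phi>) * exp (c\<^sup>2 * real (card S)))"
    unfolding m_def by (intro mult_left_mono insert.IH diff') auto
  also have "\<dots> = real (card (insert s S \<rightarrow>\<^sub>E C)) * exp (c\<^sup>2 * real (card (insert s S)))"
    using insert.hyps by (simp add: card_ins algebra_simps exp_add)
  finally show ?case unfolding m .
qed

text \<open>Markov's inequality for the exponential of \<open>- a * g\<close>, whose differences are
  at most \<open>a * c\<close>. The parameter \<open>a\<close> stays free and is chosen where the
  bound is used.\<close>

lemma bounded_differences_lower_tail:
  fixes g :: "('b \<Rightarrow> 'c) \<Rightarrow> real"
  assumes "finite S" and "finite C" and "C \<noteq> {}" and "0 \<le> a" and "a * c \<le> 1"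
    and diff: "\<And>\<phi> s x. \<phi> \<in> S \<rightarrow>\<^sub>E C \<Longrightarrow> s \<in> S \<Longrightarrow> x \<in> C \<Longrightarrow> \<bar>g (\<phi>(s := x)) - g \<phi>\<bar> \<le> c"
    and mean: "(\<Sum>\<psi>\<in>S \<rightarrow>\<^sub>E C. g \<psi>) = m * real (card (S \<rightarrow>\<^sub>E C))"
  shows "real (card {\<phi> \<in> S \<rightarrow>\<^sub>E C. g \<phi> < m - t})
    \<le> real (card (S \<rightarrow>\<^sub>E C)) * exp ((a * c)\<^sup>2 * real (card S) - a * t)"
proof -
  let ?\<Phi> = "S \<rightarrow>\<^sub>E C"
  have fin: "finite ?\<Phi>" using assms by (intro finite_PiE) auto
  have "?\<Phi> \<noteq> {}" using assms by (simp add: PiE_eq_empty_iff)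
  then have pos: "real (card ?\<Phi>) > 0" using fin by (simp add: card_gt_0_iff)
  have mean': "(\<Sum>\<psi>\<in>?\<Phi>. - a * g \<psi>) / real (card ?\<Phi>) = - a * m"
    unfolding sum_distrib_left[symmetric] mean using pos by simp
  have "real (card {\<phi> \<in> ?\<Phi>. g \<phi> < m - t}) * exp (a * t)
      = (\<Sum>\<phi>\<in>{\<phi> \<in> ?\<Phi>. g \<phi> < m - t}. exp (a * t))"
    by simp
  also have "\<dots> \<le> (\<Sum>\<phi>\<in>{\<phi> \<in> ?\<Phi>. g \<phi> < m - t}. exp (- a * g \<phi> - - a * m))"
  proof (rule sum_mono)
    fix \<phi> assume "\<phi> \<in> {\<phi> \<in> ?\<Phi>. g \<phi> < m - t}"
    then have "a * t \<le> a * (m - g \<phi>)" using assms by (intro mult_left_mono) auto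
    then show "exp (a * t) \<le> exp (- a * g \<phi> - - a * m)" by (simp add: algebra_simps)
  qed
  also have "\<dots> \<le> (\<Sum>\<phi>\<in>?\<Phi>. exp (- a * g \<phi> - - a * m))"
    using fin by (intro sum_mono2) auto
  also have "\<dots> \<le> real (card ?\<Phi>) * exp ((a * c)\<^sup>2 * real (card S))"
    unfolding mean'[symmetric]
  proof (rule bounded_differences_exp_sum)
    fix \<phi> s x assume "\<phi> \<in> ?\<Phi>" "s \<in> S" "x \<in> C"
    then have "a * \<bar>g (\<phi>(s := x)) - g \<phi>\<bar> \<le> a * c" using assms by (intro mult_left_mono) auto
    moreover have "- a * g (\<phi>(s := x)) - - a * g \<phi> = - (a * (g (\<phi>(s := x)) - g \<phi>))"
      by (simp add: algebra_simps)
    then have "\<bar>- a * g (\<phi>(s := x)) - - a * g \<phi>\<bar> = a * \<bar>g (\<phi>(s := x)) - g \<phi>\<bar>"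
      using \<open>0 \<le> a\<close> by (simp only: abs_minus_cancel abs_mult abs_of_nonneg)
    ultimately show "\<bar>- a * g (\<phi>(s := x)) - - a * g \<phi>\<bar> \<le> a * c" by simp
  qed (use assms in auto)
  finally show ?thesis by (simp add: exp_diff field_simps)
qed

section \<open>Counting functions with prescribed values\<close>

text \<open>Prescribing the values at the places \<open>h l\<close> amounts to membership in a
  dependent product \<open>T\<close> whose factors there are singletons, so only the remaining
  factors contribute to the count.\<close>

lemma card_extensions:
  assumes "finite S" and "inj_on h I" and "h ` I \<subseteq> S" and "finite C" and "p \<in> I \<rightarrow>\<^sub>E C"
  shows "card {\<phi> \<in> S \<rightarrow>\<^sub>E C. (\<lambda>l\<in>I. \<phi> (h l)) = p} = card C ^ (card S - card I)"
proof -
  define T where "T s = (if s \<in> h ` I then {p (inv_into I h s)} else C)" for s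
  have "{\<phi> \<in> S \<rightarrow>\<^sub>E C. (\<lambda>l\<in>I. \<phi> (h l)) = p} = Pi\<^sub>E S T"
  proof (intro equalityI subsetI)
    fix \<phi> assume "\<phi> \<in> {\<phi> \<in> S \<rightarrow>\<^sub>E C. (\<lambda>l\<in>I. \<phi> (h l)) = p}"
    then have \<phi>: "\<phi> \<in> S \<rightarrow>\<^sub>E C" and p: "p = (\<lambda>l\<in>I. \<phi> (h l))" by auto
    show "\<phi> \<in> Pi\<^sub>E S T"
      using \<phi> assms(2) by (auto simp: PiE_iff T_def p)
  next
    fix \<phi> assume \<phi>: "\<phi> \<in> Pi\<^sub>E S T"
    have val: "\<phi> (h l) = p l" if "l \<in> I" for l
    proof -
      have "\<phi> (h l) \<in> T (h l)" using \<phi> that assms(3) by (auto simp: PiE_iff)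
      then show ?thesis using that assms(2) by (simp add: T_def)
    qed
    have "\<phi> s \<in> C" if "s \<in> S" for s
    proof (cases "s \<in> h ` I")
      case True
      then show ?thesis using val assms(5) by (auto simp: PiE_iff)
    next
      case False
      then show ?thesis using \<phi> that by (auto simp: PiE_iff T_def)
    qed
    moreover have "(\<lambda>l\<in>I. \<phi> (h l)) = p"
      using val assms(5) by (auto simp: PiE_iff extensional_def fun_eq_iff)
    ultimately show "\<phi> \<in> {\<phi> \<in> S \<rightarrow>\<^sub>E C. (\<lambda>l\<in>I. \<phi> (h l)) = p}"
      using \<phi> by (auto simp: PiE_iff)
  qed
  moreover have "card (Pi\<^sub>E S T) = (\<Prod>s\<in>S - h ` I. card C)"
    unfolding card_PiE[OF assms(1)]
    using assms(1) by (intro prod.mono_neutral_cong_right) (auto simp: T_def)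
  moreover have "card (S - h ` I) = card S - card I"
    using assms by (simp add: card_Diff_subset finite_subset card_image)
  ultimately show ?thesis by simp
qed

lemma card_pattern_extensions:
  assumes "finite S" and "inj_on h I" and "h ` I \<subseteq> S" and "finite C" and "P \<subseteq> I \<rightarrow>\<^sub>E C"
  shows "card {\<phi> \<in> S \<rightarrow>\<^sub>E C. (\<lambda>l\<in>I. \<phi> (h l)) \<in> P} = card P * card C ^ (card S - card I)"
proof -
  have finI: "finite I" using assms by (meson finite_imageD finite_subset)
  have "finite P" using assms finI by (meson finite_PiE finite_subset)
  have "{\<phi> \<in> S \<rightarrow>\<^sub>E C. (\<lambda>l\<in>I. \<phi> (h l)) \<in> P} = (\<Union>p\<in>P. {\<phi> \<in> S \<rightarrow>\<^sub>E C. (\<lambda>l\<in>I. \<phi> (h l)) = p})"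
    by auto
  also have "card \<dots> = (\<Sum>p\<in>P. card {\<phi> \<in> S \<rightarrow>\<^sub>E C. (\<lambda>l\<in>I. \<phi> (h l)) = p})"
  proof (intro card_UN_disjoint \<open>finite P\<close> ballI impI)
    have "finite (S \<rightarrow>\<^sub>E C)" using assms by (intro finite_PiE) auto
    then show "finite {\<phi> \<in> S \<rightarrow>\<^sub>E C. (\<lambda>l\<in>I. \<phi> (h l)) = p}" for p by simp
  qed auto
  also have "\<dots> = (\<Sum>p\<in>P. card C ^ (card S - card I))"
    using assms by (intro sum.cong refl card_extensions) auto
  finally show ?thesis by simp
qed

section \<open>Positions of vertices and vanishing orderings\<close>

lemma filter_mem_properties:
  assumes "distinct vs" and "e \<subseteq> set vs"
  shows "distinct (filter (\<lambda>v. v \<in> e) vs)" and "set (filter (\<lambda>v. v \<in> e) vs) = e"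
    and "length (filter (\<lambda>v. v \<in> e) vs) = card e"
proof -
  show d: "distinct (filter (\<lambda>v. v \<in> e) vs)" and s: "set (filter (\<lambda>v. v \<in> e) vs) = e"
    using assms by auto
  show "length (filter (\<lambda>v. v \<in> e) vs) = card e"
    using distinct_card[OF d] s by simp
qed

lemma bij_betw_vertex_at:
  assumes "distinct vs" and "e \<subseteq> set vs"
  shows "bij_betw (vertex_at vs e) {1..card e} e"
proof -
  note f = filter_mem_properties[OF assms]
  have "bij_betw ((!) (filter (\<lambda>v. v \<in> e) vs)) {..<card e} e"
    using f by (intro bij_betw_nth) auto
  \<comment> \<open>Positions count from 1, list indices from 0.\<close>
  moreover have "bij_betw (\<lambda>l. l - 1) {1..card e} {..<card e}"
    by (rule bij_betw_byWitness[where f' = Suc]) auto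
  ultimately have "bij_betw ((!) (filter (\<lambda>v. v \<in> e) vs) \<circ> (\<lambda>l. l - 1)) {1..card e} e"
    by (rule bij_betw_trans[rotated])
  then show ?thesis by (simp add: vertex_at_def[abs_def] comp_def)
qed

text \<open>A colouring of the shadow yields the partition: class \<open>l\<close> collects the
  shadow sets with colour in \<open>A l\<close>. Disjointness is inherited from \<open>A\<close>,
  and the classes cover the shadow because each of its sets omits the vertex at some position of an
  edge.\<close>

lemma vanishing_if_coloured:
  assumes "0 < k" and vs: "distinct vs" "set vs = verts F"
    and F: "\<And>e. e \<in> hedges F \<Longrightarrow> e \<subseteq> verts F \<and> card e = k"
    and A: "disjoint_family_on A {1..k}"
    and col: "\<And>e l. e \<in> hedges F \<Longrightarrow> l \<in> {1..k} \<Longrightarrow> \<chi> (e - {vertex_at vs e l}) \<in> A l"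
  shows "vanishing k vs F"
proof -
  define C where "C l = {S \<in> shadow k F. \<chi> S \<in> A l}" for l
  have bij: "bij_betw (vertex_at vs e) {1..k} e" if "e \<in> hedges F" for e
    using bij_betw_vertex_at[of vs e] vs F[OF that] by auto
  have fin: "finite e" if "e \<in> hedges F" for e
    using F[OF that] vs by (metis List.finite_set finite_subset)
  have sh: "e - {vertex_at vs e l} \<in> shadow k F" if "e \<in> hedges F" "l \<in> {1..k}" for e l
  proof -
    have "vertex_at vs e l \<in> e" using bij_betwE[OF bij[OF that(1)]] that by auto
    then have "e - {vertex_at vs e l} \<in> nsets e (k - 1)"
      using F[OF that(1)] fin[OF that(1)] by (auto simp: nsets_def)
    then show ?thesis using that by (auto simp: shadow_def)
  qed
  have "S \<in> (\<Union>l\<in>{1..k}. C l)" if S: "S \<in> shadow k F" for S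
  proof -
    obtain e where e: "e \<in> hedges F" "S \<subseteq> e" "card S = k - 1" "finite S"
      using S by (auto simp: shadow_def nsets_def)
    have "card (e - S) = 1" using e F[OF e(1)] \<open>0 < k\<close> by (simp add: card_Diff_subset)
    then obtain v where "e - S = {v}" by (auto simp: card_1_singleton_iff)
    then have v: "v \<in> e" "S = e - {v}" using e by auto
    obtain l where "l \<in> {1..k}" "vertex_at vs e l = v"
      using bij_betw_imp_surj_on[OF bij[OF e(1)]] v(1) by (metis imageE)
    then show ?thesis using col[OF e(1)] sh[OF e(1)] v by (force simp: C_def)
  qed
  then have "(\<Union>l\<in>{1..k}. C l) = shadow k F" by (auto simp: C_def)
  moreover have "disjoint_family_on C {1..k}"
    using A by (fastforce simp: disjoint_family_on_def C_def)
  moreover have "\<forall>e\<in>hedges F. \<forall>l\<in>{1..k}. e - {vertex_at vs e l} \<in> C l"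
    using col sh by (simp add: C_def)
  ultimately show ?thesis unfolding vanishing_def vertex_ordering_def using vs by blast
qed


section \<open>Hypergraphs defined by colourings of the facets\<close>

text \<open>\<open>e - {vertex_at [0..<n] e l}\<close> is the facet omitting the \<open>l\<close>-th
  smallest vertex. Restriction to \<open>{1..k}\<close> makes the list of colours extensional, so
  agreeing with a pattern is equality of functions.\<close>

definition pattern_graph ::
    "nat \<Rightarrow> nat \<Rightarrow> (nat \<Rightarrow> 'c) set \<Rightarrow> (nat set \<Rightarrow> 'c) \<Rightarrow> nat hypergraph" where
  "pattern_graph k n P \<phi> =
     ({0..<n}, {e \<in> nsets {0..<n} k. (\<lambda>l\<in>{1..k}. \<phi> (e - {vertex_at [0..<n] e l})) \<in> P})"

lemma kgraph_pattern_graph: "kgraph k (pattern_graph k n P \<phi>)"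
  by (auto simp: kgraph_def pattern_graph_def)

lemma bij_betw_vertex_at_upt:
  assumes "e \<in> nsets {0..<n} k"
  shows "bij_betw (vertex_at [0..<n] e) {1..k} e"
  using bij_betw_vertex_at[of "[0..<n]" e] assms by (auto simp: nsets_def)

text \<open>Only the sets \<open>insert v s\<close> with \<open>v < n\<close> can change their
  status, since every other \<open>k\<close>-set does not have \<open>s\<close> as a facet.\<close>

lemma pattern_graph_bounded_difference:
  assumes K: "K \<subseteq> nsets {0..<n} k"
  shows "\<bar>real (card (K \<inter> hedges (pattern_graph k n P (\<phi>(s := x)))))
      - real (card (K \<inter> hedges (pattern_graph k n P \<phi>)))\<bar> \<le> real n"
proof -
  define D where "D = (\<lambda>v. insert v s) ` {0..<n}"
  have D: "finite D" "card D \<le> n"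
    using card_image_le[of "{0..<n}" "\<lambda>v. insert v s"] by (auto simp: D_def)
  have finK: "finite K" using K by (rule finite_subset) (simp add: finite_imp_finite_nsets)
  have same: "e \<in> hedges (pattern_graph k n P (\<phi>(s := x))) \<longleftrightarrow> e \<in> hedges (pattern_graph k n P \<phi>)"
    if e: "e \<in> nsets {0..<n} k" "e \<notin> D" for e
  proof -
    have "e - {vertex_at [0..<n] e l} \<noteq> s" if "l \<in> {1..k}" for l
    proof
      assume "e - {vertex_at [0..<n] e l} = s"
      moreover have "vertex_at [0..<n] e l \<in> e"
        using bij_betwE[OF bij_betw_vertex_at_upt[OF e(1)]] that by auto
      ultimately have "e = insert (vertex_at [0..<n] e l) s" "vertex_at [0..<n] e l \<in> {0..<n}"
        using e(1) by (auto simp: nsets_def)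
      then show False using e(2) by (auto simp: D_def)
    qed
    then have "(\<lambda>l\<in>{1..k}. (\<phi>(s := x)) (e - {vertex_at [0..<n] e l}))
        = (\<lambda>l\<in>{1..k}. \<phi> (e - {vertex_at [0..<n] e l}))"
      by (intro restrict_ext) simp
    then show ?thesis by (simp add: pattern_graph_def)
  qed
  \<comment> \<open>One-sided and stated for arbitrary \<open>A\<close> and \<open>B\<close>, so
    that swapping them gives the absolute value.\<close>
  have half: "real (card (K \<inter> A)) - real (card (K \<inter> B)) \<le> real n"
    if "\<And>e. e \<in> nsets {0..<n} k \<Longrightarrow> e \<notin> D \<Longrightarrow> e \<in> A \<longleftrightarrow> e \<in> B" for A B
  proof -
    have "K \<inter> A \<subseteq> (K \<inter> B) \<union> D" using that K by auto
    then have "card (K \<inter> A) \<le> card ((K \<inter> B) \<union> D)"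
      using finK D by (intro card_mono) auto
    also have "\<dots> \<le> card (K \<inter> B) + n"
      using card_Un_le[of "K \<inter> B" D] D by linarith
    finally show ?thesis by linarith
  qed
  show ?thesis
    using half[OF same] half[OF same[symmetric]] by (simp add: abs_le_iff)
qed

text \<open>Linearity of expectation. The \<open>k\<close> facets of a \<open>k\<close>-set are
  distinct, so their colours are independent and each single pattern has probability
  \<open>1 / card C ^ k\<close>.\<close>

lemma pattern_graph_mean:
  assumes K: "K \<subseteq> nsets {0..<n} k" and C: "finite C" "C \<noteq> {}" and P: "P \<subseteq> {1..k} \<rightarrow>\<^sub>E C"
  shows "(\<Sum>\<phi>\<in>nsets {0..<n} (k - 1) \<rightarrow>\<^sub>E C. real (card (K \<inter> hedges (pattern_graph k n P \<phi>))))
    = real (card P) / real (card C) ^ k * real (card K)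
        * real (card (nsets {0..<n} (k - 1) \<rightarrow>\<^sub>E C))"
proof -
  let ?S = "nsets {0..<n} (k - 1)"
  let ?\<Phi> = "?S \<rightarrow>\<^sub>E C"
  have finK: "finite K" using K by (rule finite_subset) (simp add: finite_imp_finite_nsets)
  have finS: "finite ?S" by (simp add: finite_imp_finite_nsets)
  have fin\<Phi>: "finite ?\<Phi>" using finS C by (intro finite_PiE) auto
  have q: "real (card C) > 0" using C by (simp add: card_gt_0_iff)
  have one: "real (card {\<phi> \<in> ?\<Phi>. e \<in> hedges (pattern_graph k n P \<phi>)})
      = real (card P) / real (card C) ^ k * real (card ?\<Phi>)" if "e \<in> K" for e
  proof -
    have e: "e \<in> nsets {0..<n} k" using that K by auto
    define h where "h l = e - {vertex_at [0..<n] e l}" for l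
    note bij = bij_betw_vertex_at_upt[OF e]
    have inj: "inj_on h {1..k}"
    proof (rule inj_onI)
      fix l l' assume l: "l \<in> {1..k}" "l' \<in> {1..k}" and eq: "h l = h l'"
      have "vertex_at [0..<n] e l \<in> e" "vertex_at [0..<n] e l' \<in> e"
        using bij_betwE[OF bij] l by auto
      then have "vertex_at [0..<n] e l = vertex_at [0..<n] e l'" using eq by (auto simp: h_def)
      then show "l = l'" using inj_onD[OF bij_betw_imp_inj_on[OF bij]] l by blast
    qed
    have sub: "h ` {1..k} \<subseteq> ?S"
    proof (rule image_subsetI)
      fix l assume "l \<in> {1..k}"
      then have "vertex_at [0..<n] e l \<in> e" using bij_betwE[OF bij] by blast
      then show "h l \<in> ?S" using e by (auto simp: h_def nsets_def)
    qed
    \<comment> \<open>This keeps the exponent \<open>card ?S - k\<close> from being truncated, so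
      that the power can be written as a quotient.\<close>
    have "card {1..k} \<le> card ?S" using inj sub finS by (rule card_inj_on_le)
    then have le: "k \<le> card ?S" by simp
    have "{\<phi> \<in> ?\<Phi>. e \<in> hedges (pattern_graph k n P \<phi>)} = {\<phi> \<in> ?\<Phi>. (\<lambda>l\<in>{1..k}. \<phi> (h l)) \<in> P}"
      using e by (simp add: pattern_graph_def h_def)
    then have "card {\<phi> \<in> ?\<Phi>. e \<in> hedges (pattern_graph k n P \<phi>)} = card P * card C ^ (card ?S - k)"
      using card_pattern_extensions[OF finS inj sub C(1) P] by simp
    moreover have "real (card C) ^ (card ?S - k) = real (card C) ^ card ?S / real (card C) ^ k"
      using q le by (intro power_diff) auto
    moreover have "real (card ?\<Phi>) = real (card C) ^ card ?S"
      by (simp only: card_funcsetE[OF finS] of_nat_power)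
    ultimately show ?thesis by (simp only: of_nat_mult of_nat_power) simp
  qed
  have "(\<Sum>\<phi>\<in>?\<Phi>. real (card (K \<inter> hedges (pattern_graph k n P \<phi>))))
      = (\<Sum>\<phi>\<in>?\<Phi>. \<Sum>e\<in>K. of_bool (e \<in> hedges (pattern_graph k n P \<phi>)))"
    using finK by (simp add: of_bool_def sum.If_cases Int_def)
  also have "\<dots> = (\<Sum>e\<in>K. \<Sum>\<phi>\<in>?\<Phi>. of_bool (e \<in> hedges (pattern_graph k n P \<phi>)))"
    by (rule sum.swap)
  also have "\<dots> = (\<Sum>e\<in>K. real (card {\<phi> \<in> ?\<Phi>. e \<in> hedges (pattern_graph k n P \<phi>)}))"
    using fin\<Phi> by (simp add: of_bool_def sum.If_cases Int_def)
  also have "\<dots> = (\<Sum>e\<in>K. real (card P) / real (card C) ^ k * real (card ?\<Phi>))"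
    by (intro sum.cong refl one)
  finally show ?thesis by simp
qed

section \<open>Density of a random pattern graph\<close>

lemma ex_dense_pattern_graph:
  assumes "2 \<le> k" and C: "finite C" "C \<noteq> {}" and P: "P \<subseteq> {1..k} \<rightarrow>\<^sub>E C" and "0 < \<mu>"
  shows "\<exists>n\<ge>n\<^sub>0. \<exists>\<phi>.
    dense_hypergraph k (real (card P) / real (card C) ^ k) \<mu> (k - 2) (pattern_graph k n P \<phi>)"
proof -
  \<comment> \<open>Capping at 1 secures the hypothesis \<open>a * c \<le> 1\<close> of the tail
    bound, where the product will be \<open>\<nu> / 2\<close>.\<close>
  define \<nu> where "\<nu> = min \<mu> 1"
  have \<nu>: "0 < \<nu>" "\<nu> \<le> \<mu>" "\<nu> \<le> 1" using \<open>0 < \<mu>\<close> by (auto simp: \<nu>_def)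
  obtain n1 :: nat where n1: "4 / \<nu>\<^sup>2 < real n1" using reals_Archimedean2 by blast
  \<comment> \<open>The bound \<open>n1\<close> makes the tail exponent exceed
    \<open>n ^ (k - 2)\<close>; the bound \<open>k\<close> lets binomial coefficients be estimated
    by powers.\<close>
  define n where "n = max n1 (max n\<^sub>0 k)"
  have n: "n\<^sub>0 \<le> n" "k \<le> n" "0 < n" using assms(1) by (auto simp: n_def)
  have "4 / \<nu>\<^sup>2 < real n" using n1 by (simp add: n_def)
  then have n4: "1 < \<nu>\<^sup>2 / 4 * real n" using \<nu> by (simp add: field_simps)
  let ?d = "real (card P) / real (card C) ^ k"
  let ?S = "nsets {0..<n} (k - 1)" and ?J = "nsets {0..<n} (k - 2)"
  let ?\<Phi> = "?S \<rightarrow>\<^sub>E C"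
  let ?K = "\<lambda>E. kcliques k (k - 2) ({0..<n}, E)"
  let ?X = "\<lambda>E \<phi>. real (card (?K E \<inter> hedges (pattern_graph k n P \<phi>)))"
  define bad where "bad E = {\<phi> \<in> ?\<Phi>. ?X E \<phi> < ?d * real (card (?K E)) - \<nu> * real n ^ k}" for E
  have finS: "finite ?S" and finJ: "finite ?J" by (simp_all add: finite_imp_finite_nsets)
  have fin\<Phi>: "finite ?\<Phi>" using finS C by (intro finite_PiE) auto
  have "?\<Phi> \<noteq> {}" using C by (simp add: PiE_eq_empty_iff)
  then have pos: "0 < card ?\<Phi>" using fin\<Phi> by (simp add: card_gt_0_iff)
  have cardS: "real (card ?S) \<le> real n ^ (k - 1)"
  proof -
    have "card (nsets {0..<n} (k - 1)) \<le> n ^ (k - 1)"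
      using binomial_le_pow[of "k - 1" n] n unfolding binomial_eq_nsets by simp
    then show ?thesis by (metis of_nat_le_iff of_nat_power)
  qed
  have cardJ: "real (card ?J) \<le> real n ^ (k - 2)"
  proof -
    have "card (nsets {0..<n} (k - 2)) \<le> n ^ (k - 2)"
      using binomial_le_pow[of "k - 2" n] n unfolding binomial_eq_nsets by simp
    then show ?thesis by (metis of_nat_le_iff of_nat_power)
  qed
  have pow: "real n ^ k = real n * real n ^ (k - 1)" "real n ^ (k - 1) = real n * real n ^ (k - 2)"
    using assms(1) by (simp_all flip: power_Suc add: Suc_diff_Suc numeral_2_eq_2)
  have bad: "real (card (bad E)) \<le> real (card ?\<Phi>) * exp (- (\<nu>\<^sup>2 / 4 * real n ^ (k - 1)))" for E
  proof -
    \<comment> \<open>This choice minimises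
      \<open>(a * n)\<^sup>2 * n ^ (k - 1) - a * \<nu> * n ^ k\<close>, with minimum
      \<open>- (\<nu>\<^sup>2 / 4 * n ^ (k - 1))\<close>.\<close>
    define a where "a = \<nu> / (2 * real n)"
    have a: "0 \<le> a" "a * real n = \<nu> / 2" using \<nu> n by (auto simp: a_def)
    have KE: "?K E \<subseteq> nsets {0..<n} k" by (auto simp: kcliques_def)
    have "real (card (bad E))
        \<le> real (card ?\<Phi>) * exp ((a * real n)\<^sup>2 * real (card ?S) - a * (\<nu> * real n ^ k))"
      unfolding bad_def
    proof (rule bounded_differences_lower_tail[OF finS C a(1)])
      show "a * real n \<le> 1" using a(2) \<nu> by simp
    qed (rule pattern_graph_bounded_difference[OF KE] pattern_graph_mean[OF KE C P])+
    also have "\<dots> \<le> real (card ?\<Phi>) * exp (- (\<nu>\<^sup>2 / 4 * real n ^ (k - 1)))"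
    proof -
      have "a * (\<nu> * real n ^ k) = (a * real n) * (\<nu> * real n ^ (k - 1))"
        by (simp add: pow(1))
      also have "\<dots> = \<nu>\<^sup>2 / 2 * real n ^ (k - 1)"
        by (simp add: a(2) power2_eq_square)
      finally have 1: "a * (\<nu> * real n ^ k) = \<nu>\<^sup>2 / 2 * real n ^ (k - 1)" .
      have "(a * real n)\<^sup>2 * real (card ?S) \<le> (\<nu> / 2)\<^sup>2 * real n ^ (k - 1)"
        unfolding a(2) using cardS by (intro mult_left_mono) auto
      then have "(a * real n)\<^sup>2 * real (card ?S) - a * (\<nu> * real n ^ k)
          \<le> - (\<nu>\<^sup>2 / 4 * real n ^ (k - 1))"
        unfolding 1 by (simp add: power_divide)
      then show ?thesis by (intro mult_left_mono) auto
    qed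
    finally show ?thesis .
  qed
  \<comment> \<open>Union bound over all edge sets of \<open>(k - 2)\<close>-graphs.\<close>
  have "real (card (\<Union>E\<in>Pow ?J. bad E)) \<le> (\<Sum>E\<in>Pow ?J. real (card (bad E)))"
    using card_UN_le[of "Pow ?J" bad] finJ by (simp flip: of_nat_sum)
  also have "\<dots> \<le> (\<Sum>E\<in>Pow ?J. real (card ?\<Phi>) * exp (- (\<nu>\<^sup>2 / 4 * real n ^ (k - 1))))"
    by (intro sum_mono bad)
  also have "\<dots> = 2 ^ card ?J * (real (card ?\<Phi>) * exp (- (\<nu>\<^sup>2 / 4 * real n ^ (k - 1))))"
    using finJ by (simp add: card_Pow)
  also have "\<dots> < real (card ?\<Phi>)"
  proof -
    have "(2::real) ^ card ?J \<le> exp 1 ^ card ?J"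
      using exp_ge_add_one_self[of 1] by (intro power_mono) auto
    also have "\<dots> = exp (real (card ?J))" by (simp flip: exp_of_nat_mult)
    also have "\<dots> \<le> exp (real n ^ (k - 2))" using cardJ by simp
    also have "\<dots> < exp (\<nu>\<^sup>2 / 4 * real n ^ (k - 1))"
    proof -
      have "1 * real n ^ (k - 2) < (\<nu>\<^sup>2 / 4 * real n) * real n ^ (k - 2)"
        using n4 n by (intro mult_strict_right_mono) auto
      then show ?thesis by (simp only: pow(2) exp_less_cancel_iff mult_1 mult.assoc)
    qed
    finally show ?thesis using pos by (simp add: exp_minus field_simps)
  qed
  finally have "card (\<Union>E\<in>Pow ?J. bad E) < card ?\<Phi>" by simp
  moreover have "finite (\<Union>E\<in>Pow ?J. bad E)"
    by (rule finite_subset[OF _ fin\<Phi>]) (auto simp: bad_def)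
  ultimately have "\<not> ?\<Phi> \<subseteq> (\<Union>E\<in>Pow ?J. bad E)"
    using card_mono linorder_not_less by blast
  \<comment> \<open>One colouring is good for every \<open>E\<close> at once, as density quantifies
    over all \<open>G\<close>.\<close>
  then obtain \<phi> where \<phi>: "\<phi> \<in> ?\<Phi>" "\<And>E. E \<subseteq> ?J \<Longrightarrow> \<phi> \<notin> bad E" by blast
  have "dense_hypergraph k ?d \<mu> (k - 2) (pattern_graph k n P \<phi>)"
    unfolding dense_hypergraph_def
  proof (intro allI impI)
    fix G :: "nat hypergraph"
    assume G: "kgraph (k - 2) G \<and> verts G = verts (pattern_graph k n P \<phi>)"
    then have vG: "verts G = {0..<n}" by (simp add: pattern_graph_def)
    then obtain E where eq: "G = ({0..<n}, E)" by (metis prod.collapse)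
    have "E \<subseteq> ?J" using G by (auto simp: kgraph_def eq)
    then have "\<phi> \<notin> bad E" by (rule \<phi>(2))
    then have "?d * real (card (?K E)) - \<nu> * real n ^ k \<le> ?X E \<phi>"
      unfolding bad_def mem_Collect_eq using \<phi>(1) by (meson linorder_not_less)
    moreover have "\<nu> * real n ^ k \<le> \<mu> * real n ^ k" using \<nu> by (intro mult_right_mono) auto
    moreover have cV: "card (verts (pattern_graph k n P \<phi>)) = n" by (simp add: pattern_graph_def)
    ultimately show "?d * real (card (kcliques k (k - 2) G))
        - \<mu> * real (card (verts (pattern_graph k n P \<phi>))) ^ k
        \<le> real (card (kcliques k (k - 2) G \<inter> hedges (pattern_graph k n P \<phi>)))"
      unfolding eq cV by linarith
  qed
  then show ?thesis using n by blast
qed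

text \<open>The pattern density itself belongs to the set whose supremum is
  \<open>turan_density\<close>: it is at most 1, and for every \<mu> a large dense pattern graph
  exists.\<close>

lemma turan_density_ge_pattern:
  assumes "2 \<le> k" and C: "finite C" "C \<noteq> {}" and P: "P \<subseteq> {1..k} \<rightarrow>\<^sub>E C"
    and free: "\<And>n \<phi>. hfree F (pattern_graph k n P \<phi>)"
  shows "real (card P) / real (card C) ^ k \<le> turan_density k (k - 2) F"
  unfolding turan_density_def
proof (rule cSup_upper)
  have "finite ({1..k} \<rightarrow>\<^sub>E C)" using C by (intro finite_PiE) auto
  then have "card P \<le> card ({1..k} \<rightarrow>\<^sub>E C)" using P by (rule card_mono)
  then have "card P \<le> card C ^ k" by (simp add: card_funcsetE)
  then have "real (card P) \<le> real (card C) ^ k" by (metis of_nat_le_iff of_nat_power)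
  moreover have "0 < real (card C) ^ k" using C by (simp add: card_gt_0_iff)
  ultimately have "real (card P) / real (card C) ^ k \<in> {0..1}" by (simp add: divide_le_eq_1)
  moreover have "\<exists>H :: nat hypergraph. kgraph k H \<and> card (verts H) \<ge> n\<^sub>0 \<and> hfree F H
      \<and> dense_hypergraph k (real (card P) / real (card C) ^ k) \<mu> (k - 2) H" if "\<mu> > 0" for \<mu> n\<^sub>0
  proof -
    obtain n \<phi> where n: "n\<^sub>0 \<le> n"
      "dense_hypergraph k (real (card P) / real (card C) ^ k) \<mu> (k - 2) (pattern_graph k n P \<phi>)"
      using ex_dense_pattern_graph[OF assms(1) C P \<open>\<mu> > 0\<close>] by blast
    moreover have "card (verts (pattern_graph k n P \<phi>)) = n" by (simp add: pattern_graph_def)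
    ultimately show ?thesis using kgraph_pattern_graph free by metis
  qed
  ultimately show "real (card P) / real (card C) ^ k
      \<in> {d \<in> {0..1}. \<forall>\<mu>>0. \<forall>n\<^sub>0. \<exists>H :: nat hypergraph. kgraph k H \<and> card (verts H) \<ge> n\<^sub>0
           \<and> hfree F H \<and> dense_hypergraph k d \<mu> (k - 2) H}"
    by blast
qed (auto intro!: bdd_aboveI[where M = 1])

section \<open>Copies of \<open>F\<close> in a pattern graph force a split\<close>

text \<open>The body of \<open>spade_star\<close> for a fixed pair, so that its failure can be
  stated for that pair alone.\<close>

definition spade_split :: "nat \<Rightarrow> 'a hypergraph \<Rightarrow> nat \<Rightarrow> nat \<Rightarrow> bool" where
  "spade_split k F i j \<longleftrightarrow>
     (\<exists>F1 F2 vs.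
           verts F1 = verts F \<and> verts F2 = verts F \<and>
           hedges F1 \<union> hedges F2 = hedges F \<and> hedges F1 \<inter> hedges F2 = {} \<and>
           vanishing k vs F1 \<and> vanishing k vs F2 \<and>
           (\<forall>e1\<in>hedges F1. \<forall>e2\<in>hedges F2. card (e1 \<inter> e2) = k - 1 \<longrightarrow>
              (\<exists>l\<in>{1..k}. has_type k vs F1 l (e1 \<inter> e2) \<and> has_type k vs F2 l (e1 \<inter> e2)) \<or>
              (has_type k vs F1 i (e1 \<inter> e2) \<and> has_type k vs F2 j (e1 \<inter> e2))))"

text \<open>
  Colour \<open>0\<close> plays the part of a colour \<open>k + 1\<close>. Edges with colour \<open>j\<close> at position \<open>j\<close> (the first two
  patterns) will form \<open>F1\<close>, the others \<open>F2\<close>. A colour occurring in both classes occurs at the same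
  position, except that \<open>i\<close> occurs at position \<open>i\<close> in \<open>F1\<close> and at position \<open>j\<close> in \<open>F2\<close>.
\<close>

definition spade_patterns :: "nat \<Rightarrow> nat \<Rightarrow> nat \<Rightarrow> (nat \<Rightarrow> nat) set" where
  "spade_patterns k i j =
     {\<lambda>l\<in>{1..k}. l,
      \<lambda>l\<in>{1..k}. if l = i then 0 else l,
      \<lambda>l\<in>{1..k}. if l = i then 0 else if l = j then i else l}"

lemma card_spade_patterns:
  assumes "i \<in> {1..k}" and "j \<in> {1..k}" and "i < j"
  shows "card (spade_patterns k i j) = 3"
proof -
  let ?p = "\<lambda>l\<in>{1..k}. l" and ?q = "\<lambda>l\<in>{1..k}. if l = i then 0 else l"
    and ?r = "\<lambda>l\<in>{1..k}. if l = i then 0 else if l = j then i else l"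
  \<comment> \<open>Position \<open>i\<close> separates the first pattern from the others because
    \<open>i\<close> is not 0; position \<open>j\<close> separates the last two because
    \<open>i < j\<close>.\<close>
  have "?p i \<noteq> ?q i" "?p i \<noteq> ?r i" "?q j \<noteq> ?r j" using assms by auto
  then have "?p \<noteq> ?q" "?p \<noteq> ?r" "?q \<noteq> ?r" by metis+
  then show ?thesis unfolding spade_patterns_def by simp
qed

lemma spade_patterns_subset:
  assumes "i \<in> {1..k}"
  shows "spade_patterns k i j \<subseteq> {1..k} \<rightarrow>\<^sub>E {0..k}"
  using assms by (auto simp: spade_patterns_def)

text \<open>Listing \<open>V\<close> by increasing value of \<open>f\<close> pulls the natural order
  back along the embedding, so positions within \<open>e\<close> and within its image agree.\<close>

lemma vertex_at_embedding:
  fixes f :: "'a \<Rightarrow> nat"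
  assumes "inj_on f V" and "f ` V \<subseteq> {0..<n}"
  obtains vs where "distinct vs" and "set vs = V"
    and "\<And>e l. e \<subseteq> V \<Longrightarrow> l \<in> {1..card e} \<Longrightarrow> f (vertex_at vs e l) = vertex_at [0..<n] (f ` e) l"
proof
  define vs where "vs = map (inv_into V f) (filter (\<lambda>x. x \<in> f ` V) [0..<n])"
  have inv: "inv_into V f (f v) = v" if "v \<in> V" for v using that assms(1) by simp
  show d: "distinct vs" unfolding vs_def
    by (auto simp: distinct_map intro: inj_on_inv_into inj_on_subset)
  have "f ` V \<inter> {0..<n} = f ` V" using assms(2) by auto
  then have "set vs = inv_into V f ` f ` V"
    unfolding vs_def by (simp add: Int_def conj_commute)
  then show s: "set vs = V" using inv by (auto simp: image_iff)
  show "f (vertex_at vs e l) = vertex_at [0..<n] (f ` e) l" if e: "e \<subseteq> V" and l: "l \<in> {1..card e}" for e l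
  proof -
    \<comment> \<open>Injectivity of \<open>f\<close> on \<open>V\<close> lets filtering commute
      with \<open>map f\<close>.\<close>
    have "map f (filter (\<lambda>v. v \<in> e) vs) = filter (\<lambda>x. x \<in> f ` e) (map f vs)"
    proof -
      have "v \<in> e \<longleftrightarrow> f v \<in> f ` e" if "v \<in> set vs" for v
        using that s e assms(1) by (auto dest: inj_onD)
      then show ?thesis by (simp add: filter_map comp_def cong: filter_cong)
    qed
    also have "map f vs = filter (\<lambda>x. x \<in> f ` V) [0..<n]"
      unfolding vs_def map_map by (rule map_idI) (auto simp: f_inv_into_f)
    also have "filter (\<lambda>x. x \<in> f ` e) \<dots> = filter (\<lambda>x. x \<in> f ` e) [0..<n]"
      using e by (auto intro: filter_cong)
    finally have eq: "map f (filter (\<lambda>v. v \<in> e) vs) = filter (\<lambda>x. x \<in> f ` e) [0..<n]" .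
    have "length (filter (\<lambda>v. v \<in> e) vs) = card e"
      using filter_mem_properties(3)[OF d] s e by simp
    then have "f (filter (\<lambda>v. v \<in> e) vs ! (l - 1)) = map f (filter (\<lambda>v. v \<in> e) vs) ! (l - 1)"
      using l by (intro nth_map[symmetric]) auto
    then show ?thesis unfolding vertex_at_def eq .
  qed
qed

text \<open>The type is the position of the one vertex of \<open>e\<close> outside \<open>S\<close>.
  The equation for \<open>S\<close> is kept so that the colour of \<open>S\<close> can be read off
  at that position.\<close>

lemma ex_has_type:
  assumes "distinct vs" and "set vs = verts F" and "e \<in> hedges F" and "e \<subseteq> verts F"
    and "card e = k" and "0 < k" and "S \<subseteq> e" and "card S = k - 1"
  obtains l where "l \<in> {1..k}" and "S = e - {vertex_at vs e l}" and "has_type k vs F l S"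
proof -
  have fin: "finite e" using assms by (metis List.finite_set finite_subset)
  then have finS: "finite S" using assms(7) finite_subset by blast
  then have "card (e - S) = 1" using assms by (simp add: card_Diff_subset)
  then obtain v where "e - S = {v}" by (auto simp: card_1_singleton_iff)
  then have v: "v \<in> e" "S = e - {v}" "insert v S = e" using assms(7) by auto
  obtain l where l: "l \<in> {1..k}" "vertex_at vs e l = v"
    using bij_betw_imp_surj_on[OF bij_betw_vertex_at[of vs e]] assms v(1) by (metis imageE)
  have "has_type k vs F l S"
    unfolding has_type_def using finS assms(3,8) v(3) l(2) by blast
  then show ?thesis using that l v by blast
qed

text \<open>A copy of \<open>F\<close> pulls back both the vertex order and the colouring. Splitting
  the edges by the colour at position \<open>j\<close> then gives exactly the structure excluded by
  \<open>no\<close>.\<close>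

lemma hfree_pattern_graph_spade_patterns:
  fixes F :: "'a hypergraph"
  assumes F: "kgraph k F" and ij: "i \<in> {1..k}" "j \<in> {1..k}" "i < j"
    and no: "\<not> spade_split k F i j"
  shows "hfree F (pattern_graph k n (spade_patterns k i j) \<phi>)"
  unfolding hfree_def
proof
  let ?H = "pattern_graph k n (spade_patterns k i j) \<phi>"
  assume "\<exists>H'. subhypergraph H' ?H \<and> hisomorphic F H'"
  then obtain H' f where H': "subhypergraph H' ?H"
    and f: "bij_betw f (verts F) (verts H')" "(\<lambda>e. f ` e) ` hedges F = hedges H'"
    unfolding hisomorphic_def by blast
  have inj: "inj_on f (verts F)" using f by (simp add: bij_betw_def)
  have "f ` verts F \<subseteq> {0..<n}"
    using f(1) H' by (simp add: bij_betw_def subhypergraph_def pattern_graph_def)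
  then obtain vs where vs: "distinct vs" "set vs = verts F"
    and at: "\<And>e l. e \<subseteq> verts F \<Longrightarrow> l \<in> {1..card e} \<Longrightarrow> f (vertex_at vs e l) = vertex_at [0..<n] (f ` e) l"
    using vertex_at_embedding[OF inj] by blast
  define \<chi> where "\<chi> S = \<phi> (f ` S)" for S
  have "0 < k" using ij by auto
  have E: "e \<subseteq> verts F" "card e = k" if "e \<in> hedges F" for e
    using F that by (auto simp: kgraph_def nsets_def)
  have pat: "(\<lambda>l\<in>{1..k}. \<chi> (e - {vertex_at vs e l})) \<in> spade_patterns k i j" if e: "e \<in> hedges F" for e
  proof -
    have "f ` e \<in> hedges ?H" using e f(2) H' by (auto simp: subhypergraph_def)
    then have "(\<lambda>l\<in>{1..k}. \<phi> (f ` e - {vertex_at [0..<n] (f ` e) l})) \<in> spade_patterns k i j"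
      by (simp add: pattern_graph_def)
    moreover have "f ` e - {vertex_at [0..<n] (f ` e) l} = f ` (e - {vertex_at vs e l})"
      if l: "l \<in> {1..k}" for l
    proof -
      have "vertex_at vs e l \<in> e"
        using bij_betwE[OF bij_betw_vertex_at[of vs e]] vs E[OF e] l by auto
      then have "f ` (e - {vertex_at vs e l}) = f ` e - f ` {vertex_at vs e l}"
        using E[OF e] by (intro inj_on_image_set_diff[OF inj]) auto
      then show ?thesis using at[of e l] E[OF e] l by simp
    qed
    ultimately show ?thesis by (simp add: \<chi>_def cong: restrict_cong)
  qed
  \<comment> \<open>Every pattern has colour \<open>j\<close> or \<open>i\<close> at position
    \<open>j\<close>, so these two edge sets partition the edges of \<open>F\<close>.\<close>
  define F1 where "F1 = (verts F, {e \<in> hedges F. \<chi> (e - {vertex_at vs e j}) = j})"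
  define F2 where "F2 = (verts F, {e \<in> hedges F. \<chi> (e - {vertex_at vs e j}) = i})"
  \<comment> \<open>Colours possible at position \<open>l\<close>: \<open>A\<close> for edges of
    \<open>F1\<close>, whose two patterns differ only at \<open>i\<close>, and \<open>B\<close> for
    edges of \<open>F2\<close>.\<close>
  define A where "A l = (if l = i then {0, i} else {l})" for l
  define B where "B l = (if l = i then {0} else if l = j then {i} else {l})" for l
  have val: "\<exists>p\<in>spade_patterns k i j. \<forall>l\<in>{1..k}. \<chi> (e - {vertex_at vs e l}) = p l"
    if "e \<in> hedges F" for e
    using pat[OF that] by (rule rev_bexI) simp
  have cover: "\<chi> (e - {vertex_at vs e j}) \<in> {i, j}" if "e \<in> hedges F" for e
    using val[OF that] ij by (auto simp: spade_patterns_def)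
  have A: "\<chi> (e - {vertex_at vs e l}) \<in> A l" if "e \<in> hedges F1" "l \<in> {1..k}" for e l
    using val[of e] that ij by (auto simp: spade_patterns_def A_def F1_def split: if_splits)
  have B: "\<chi> (e - {vertex_at vs e l}) \<in> B l" if "e \<in> hedges F2" "l \<in> {1..k}" for e l
    using val[of e] that ij by (auto simp: spade_patterns_def B_def F2_def split: if_splits)
  have E1: "e \<subseteq> verts F1" "card e = k" if "e \<in> hedges F1" for e
    using E that by (auto simp: F1_def)
  have E2: "e \<subseteq> verts F2" "card e = k" if "e \<in> hedges F2" for e
    using E that by (auto simp: F2_def)
  have vs1: "set vs = verts F1" and vs2: "set vs = verts F2" by (simp_all add: vs F1_def F2_def)
  have "vanishing k vs F1"
  proof (rule vanishing_if_coloured[where \<chi> = \<chi> and A = A])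
    show "disjoint_family_on A {1..k}" by (auto simp: disjoint_family_on_def A_def)
  qed (use \<open>0 < k\<close> vs(1) vs1 E1 A in auto)
  moreover have "vanishing k vs F2"
  proof (rule vanishing_if_coloured[where \<chi> = \<chi> and A = B])
    show "disjoint_family_on B {1..k}" using ij by (auto simp: disjoint_family_on_def B_def)
  qed (use \<open>0 < k\<close> vs(1) vs2 E2 B in auto)
  moreover have "(\<exists>l\<in>{1..k}. has_type k vs F1 l (e1 \<inter> e2) \<and> has_type k vs F2 l (e1 \<inter> e2)) \<or>
      (has_type k vs F1 i (e1 \<inter> e2) \<and> has_type k vs F2 j (e1 \<inter> e2))"
    if e: "e1 \<in> hedges F1" "e2 \<in> hedges F2" and c: "card (e1 \<inter> e2) = k - 1" for e1 e2
  proof -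
    obtain l1 where l1: "l1 \<in> {1..k}" "e1 \<inter> e2 = e1 - {vertex_at vs e1 l1}" "has_type k vs F1 l1 (e1 \<inter> e2)"
      using ex_has_type[OF vs(1) vs1 e(1) E1[OF e(1)] \<open>0 < k\<close> _ c] by blast
    obtain l2 where l2: "l2 \<in> {1..k}" "e1 \<inter> e2 = e2 - {vertex_at vs e2 l2}" "has_type k vs F2 l2 (e1 \<inter> e2)"
      using ex_has_type[OF vs(1) vs2 e(2) E2[OF e(2)] \<open>0 < k\<close> _ c] by blast
    \<comment> \<open>The common facet has one colour, seen from both edges. \<open>A l1\<close> and
      \<open>B l2\<close> meet only for equal positions or, in colour \<open>i\<close>, for
      \<open>l1 = i\<close> and \<open>l2 = j\<close>.\<close>
    have "\<chi> (e1 \<inter> e2) \<in> A l1 \<inter> B l2" using A[OF e(1) l1(1)] B[OF e(2) l2(1)] l1(2) l2(2) by simp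
    then have "l1 = l2 \<or> (l1 = i \<and> l2 = j)" using l1(1) l2(1) by (auto simp: A_def B_def split: if_splits)
    then show ?thesis using l1 l2 by blast
  qed
  moreover have "hedges F1 \<union> hedges F2 = hedges F" "hedges F1 \<inter> hedges F2 = {}"
    using cover ij by (auto simp: F1_def F2_def)
  moreover have "verts F1 = verts F" "verts F2 = verts F" by (simp_all add: F1_def F2_def)
  ultimately show False using no unfolding spade_split_def by blast
qed

section \<open>The numerical inequality and the conclusion\<close>

text \<open>This is \<open>(1 + 1 / k) ^ k < exp 1 \<le> 3\<close>; the quadratic Taylor term of
  \<open>exp (1 / k)\<close> makes the first inequality strict.\<close>

lemma succ_power_less:
  assumes "1 \<le> k"
  shows "(real k + 1) ^ k < 3 * real k ^ k"
proof -
  let ?x = "1 / real k"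
  have x: "0 < ?x" using assms by simp
  have "1 + ?x < 1 + ?x + ?x\<^sup>2 / 2" using x by simp
  also have "\<dots> \<le> exp ?x" using x by (intro exp_lower_Taylor_quadratic) simp
  finally have "(1 + ?x) ^ k < exp ?x ^ k" using assms x by (intro power_strict_mono) auto
  also have "\<dots> = exp 1" using assms by (simp flip: exp_of_nat_mult)
  also have "\<dots> \<le> 3" by (rule exp_le)
  finally have "(1 + ?x) ^ k * real k ^ k < 3 * real k ^ k"
    using assms by (intro mult_strict_right_mono) auto
  moreover have "(1 + ?x) * real k = real k + 1" using assms by (simp add: field_simps)
  ultimately show ?thesis by (simp flip: power_mult_distrib)
qed

theorem theorem7p1:
  fixes F :: "'a hypergraph" and k :: nat
  assumes "k \<ge> 3"
    and "kgraph k F"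
    and "\<not> spade_star k F"
  shows "turan_density k (k - 2) F \<ge> 3 / (real k + 1) ^ k \<and>
         3 / (real k + 1) ^ k > 1 / real k ^ k"
proof
  obtain i j where ij: "i \<in> {1..k}" "j \<in> {1..k}" "i < j"
    and no: "\<not> spade_split k F i j"
    using assms(3) unfolding spade_star_def spade_split_def by blast
  \<comment> \<open>Three patterns over the \<open>k + 1\<close> colours \<open>{0..k}\<close> give
    the constant.\<close>
  have "real (card (spade_patterns k i j)) / real (card {0..k}) ^ k \<le> turan_density k (k - 2) F"
    using assms(1) hfree_pattern_graph_spade_patterns[OF assms(2) ij no] spade_patterns_subset[OF ij(1)]
    by (intro turan_density_ge_pattern) auto
  then show "turan_density k (k - 2) F \<ge> 3 / (real k + 1) ^ k"
    by (simp add: card_spade_patterns[OF ij] add.commute)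
  show "3 / (real k + 1) ^ k > 1 / real k ^ k"
    using succ_power_less[of k] assms(1) by (simp add: field_simps)
qed

end
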